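(* Let $B \subseteq A$ be finite-dimensional semisimple complex algebras ($B$ a unital subalgebra of $A$) such that $A \supseteq B$ is a uniquely separable Frobenius extension. Then $B \subseteq A$ has depth $1$, i.e. $d(B,A) = 1$.
   Context: $A \supseteq B$ is a Frobenius extension if there is a $B$-$B$-bimodule homomorphism $E : A \to B$ (a Frobenius homomorphism) and elements (dual bases) $x_1,\dots,x_n,y_1,\dots,y_n \in A$ such that $a = \sum_{i} E(a x_i) y_i = \sum_{i} x_i E(y_i a)$ for all $a \in A$. The element $[A:B]_E := \sum_i x_i y_i$ lies in the center $Z(A)$ and is called the $E$-index. A separability element of $A \supseteq B$ is an element $e = e^1 \otimes_B e^2 \in A \otimes_B A$ (summation suppressed) with $ae = ea$ for all $a \in A$ and $e^1 e^2 = 1$. $A \supseteq B$ is a uniquely separable Frobenius extension if it is a Frobenius extension with some Frobenius homomorphism $E$ whose $E$-index $[A:B]_E$ is invertible in $Z(A)$, and $A \supseteq B$ has exactly one separability element (necessarily $[A:B]_E^{-1}\sum_i x_i \otimes_B y_i$). $B \subseteq A$ has depth $1$, written $d(B,A)=1$, if for some positive integer $n$ the natural $B$-$B$-bimodule $A$ is isomorphic to a direct summand of the direct sum of $n$ copies of ${}_BB_B$ (equivalently, ${}_BA_B$ and ${}_BB_B$ are each isomorphic to a direct summand of a finite direct sum of copies of the other). *)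

theory Defs
  imports Complex_Main "HOL-Library.Multiset" "HOL-Library.FuncSet" "HOL-Library.Function_Algebras"
begin

section \<open>Complex algebras\<close>

text \<open>The sort \<open>{ring, monoid_mult}\<close> is that of unital rings, the zero ring included
  (which \<^class>\<open>ring_1\<close> would exclude).\<close>

locale complex_algebra = vector_space scale
  for scale :: "complex \<Rightarrow> 'a::{ring,monoid_mult} \<Rightarrow> 'a" +
  assumes scale_mult_left: "scale c (x * y) = scale c x * y"
    and scale_mult_right: "scale c (x * y) = x * scale c y"
begin

definition unital_subalgebra :: "'a set \<Rightarrow> bool" where
  "unital_subalgebra R \<longleftrightarrow> subspace R \<and> 1 \<in> R \<and> (\<forall>x\<in>R. \<forall>y\<in>R. x * y \<in> R)"

definition finite_dimensional :: "'a set \<Rightarrow> bool" where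
  "finite_dimensional R \<longleftrightarrow> (\<exists>S. finite S \<and> span S = R)"

end

definition direct_sum :: "'m::ab_group_add set \<Rightarrow> 'm set \<Rightarrow> 'm set \<Rightarrow> bool" where
  "direct_sum M P Q \<longleftrightarrow> M = {u + v |u v. u \<in> P \<and> v \<in> Q} \<and> P \<inter> Q = {0}"

definition left_ideal :: "'a::{ring,monoid_mult} set \<Rightarrow> 'a set \<Rightarrow> bool" where
  "left_ideal R I \<longleftrightarrow> I \<subseteq> R \<and> 0 \<in> I \<and> (\<forall>u\<in>I. \<forall>v\<in>I. u - v \<in> I) \<and> (\<forall>r\<in>R. \<forall>u\<in>I. r * u \<in> I)"

text \<open>The regular left module is semisimple: every submodule is a direct summand.\<close>

definition semisimple :: "'a::{ring,monoid_mult} set \<Rightarrow> bool" where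
  "semisimple R \<longleftrightarrow> (\<forall>I. left_ideal R I \<longrightarrow> (\<exists>J. left_ideal R J \<and> direct_sum R I J))"

definition fd_semisimple_algebra ::
    "(complex \<Rightarrow> 'a::{ring,monoid_mult} \<Rightarrow> 'a) \<Rightarrow> 'a set \<Rightarrow> bool" where
  "fd_semisimple_algebra scale R \<longleftrightarrow>
     complex_algebra.unital_subalgebra scale R \<and>
     complex_algebra.finite_dimensional scale R \<and>
     semisimple R"

section \<open>Bimodules\<close>

text \<open>In what follows \<open>l\<close>, \<open>r\<close> (and \<open>l'\<close>, \<open>r'\<close>) are the left and right actions of \<open>B\<close>.\<close>

definition sub_bimodule ::
    "'a set \<Rightarrow> ('a \<Rightarrow> 'm \<Rightarrow> 'm) \<Rightarrow> ('m \<Rightarrow> 'a \<Rightarrow> 'm) \<Rightarrow> 'm::ab_group_add set \<Rightarrow> 'm set \<Rightarrow> bool" where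
  "sub_bimodule B l r M P \<longleftrightarrow> P \<subseteq> M \<and> 0 \<in> P \<and> (\<forall>u\<in>P. \<forall>v\<in>P. u - v \<in> P) \<and>
     (\<forall>b\<in>B. \<forall>u\<in>P. l b u \<in> P \<and> r u b \<in> P)"

definition direct_summand ::
    "'a set \<Rightarrow> ('a \<Rightarrow> 'm \<Rightarrow> 'm) \<Rightarrow> ('m \<Rightarrow> 'a \<Rightarrow> 'm) \<Rightarrow> 'm::ab_group_add set \<Rightarrow> 'm set \<Rightarrow> bool" where
  "direct_summand B l r M P \<longleftrightarrow>
     sub_bimodule B l r M P \<and> (\<exists>Q. sub_bimodule B l r M Q \<and> direct_sum M P Q)"

definition bimodule_hom ::
    "'a set \<Rightarrow> ('a \<Rightarrow> 'm \<Rightarrow> 'm) \<Rightarrow> ('m \<Rightarrow> 'a \<Rightarrow> 'm) \<Rightarrow> ('a \<Rightarrow> 'n \<Rightarrow> 'n) \<Rightarrow> ('n \<Rightarrow> 'a \<Rightarrow> 'n) \<Rightarrow>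
     'm::ab_group_add set \<Rightarrow> 'n::ab_group_add set \<Rightarrow> ('m \<Rightarrow> 'n) \<Rightarrow> bool" where
  "bimodule_hom B l r l' r' M N f \<longleftrightarrow> f \<in> M \<rightarrow> N \<and>
     (\<forall>u\<in>M. \<forall>v\<in>M. f (u + v) = f u + f v) \<and>
     (\<forall>b\<in>B. \<forall>u\<in>M. f (l b u) = l' b (f u) \<and> f (r u b) = r' (f u) b)"

definition bimodule_iso ::
    "'a set \<Rightarrow> ('a \<Rightarrow> 'm \<Rightarrow> 'm) \<Rightarrow> ('m \<Rightarrow> 'a \<Rightarrow> 'm) \<Rightarrow> ('a \<Rightarrow> 'n \<Rightarrow> 'n) \<Rightarrow> ('n \<Rightarrow> 'a \<Rightarrow> 'n) \<Rightarrow>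
     'm::ab_group_add set \<Rightarrow> 'n::ab_group_add set \<Rightarrow> ('m \<Rightarrow> 'n) \<Rightarrow> bool" where
  "bimodule_iso B l r l' r' M N f \<longleftrightarrow> bimodule_hom B l r l' r' M N f \<and> bij_betw f M N"

text \<open>The direct sum of \<open>n\<close> copies of \<open>B\<close>: sequences in \<open>B\<close> vanishing from index \<open>n\<close> on, with
  pointwise addition and actions.\<close>

definition copies :: "nat \<Rightarrow> 'a::{ring,monoid_mult} set \<Rightarrow> (nat \<Rightarrow> 'a) set" where
  "copies n B = {u. (\<forall>i<n. u i \<in> B) \<and> (\<forall>i\<ge>n. u i = 0)}"

definition left_mult :: "'a::{ring,monoid_mult} \<Rightarrow> (nat \<Rightarrow> 'a) \<Rightarrow> nat \<Rightarrow> 'a" where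
  "left_mult b u = (\<lambda>i. b * u i)"

definition right_mult :: "(nat \<Rightarrow> 'a::{ring,monoid_mult}) \<Rightarrow> 'a \<Rightarrow> nat \<Rightarrow> 'a" where
  "right_mult u b = (\<lambda>i. u i * b)"

text \<open>Depth one of the subring \<open>B\<close> of the ring \<open>A\<close> formed by the whole type.\<close>

definition depth_one :: "'a::{ring,monoid_mult} set \<Rightarrow> bool" where
  "depth_one B \<longleftrightarrow> (\<exists>n>0. \<exists>P f. direct_summand B left_mult right_mult (copies n B) P \<and>
     bimodule_iso B (*) (*) left_mult right_mult UNIV P f)"

section \<open>The tensor product of \<open>A\<close> with itself over \<open>B\<close>\<close>

text \<open>A finite formal sum of pure tensors is a multiset of pairs. The tensor product is the quotient
  of this free commutative monoid by the congruence below; the quotient is already a group, the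
  inverse of the class of \<open>(x, y)\<close> being that of \<open>(-x, y)\<close>, so it agrees with the usual quotient of
  the free abelian group.\<close>

inductive tensor_eq ::
    "'a::{ring,monoid_mult} set \<Rightarrow> ('a \<times> 'a) multiset \<Rightarrow> ('a \<times> 'a) multiset \<Rightarrow> bool"
  for B where
  refl: "tensor_eq B M M"
| sym: "tensor_eq B M N \<Longrightarrow> tensor_eq B N M"
| trans: "tensor_eq B M N \<Longrightarrow> tensor_eq B N L \<Longrightarrow> tensor_eq B M L"
| cong: "tensor_eq B M N \<Longrightarrow> tensor_eq B (M + L) (N + L)"
| zero: "tensor_eq B {#(0, y)#} {#}"
| add_left: "tensor_eq B {#(x + x', y)#} {#(x, y), (x', y)#}"
| add_right: "tensor_eq B {#(x, y + y')#} {#(x, y), (x, y')#}"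
| balanced: "b \<in> B \<Longrightarrow> tensor_eq B {#(x * b, y)#} {#(x, b * y)#}"

definition tensor_rel ::
    "'a::{ring,monoid_mult} set \<Rightarrow> (('a \<times> 'a) multiset \<times> ('a \<times> 'a) multiset) set" where
  "tensor_rel B = {(M, N). tensor_eq B M N}"

definition tensor :: "'a::{ring,monoid_mult} set \<Rightarrow> ('a \<times> 'a) multiset set set" where
  "tensor B = UNIV // tensor_rel B"

text \<open>The \<open>A\<close>-\<open>A\<close>-bimodule structure and the multiplication map, on classes of formal sums.\<close>

definition tensor_left ::
    "'a::{ring,monoid_mult} set \<Rightarrow> 'a \<Rightarrow> ('a \<times> 'a) multiset set \<Rightarrow> ('a \<times> 'a) multiset set" where
  "tensor_left B a T = tensor_rel B `` (image_mset (\<lambda>(x, y). (a * x, y)) ` T)"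

definition tensor_right ::
    "'a::{ring,monoid_mult} set \<Rightarrow> ('a \<times> 'a) multiset set \<Rightarrow> 'a \<Rightarrow> ('a \<times> 'a) multiset set" where
  "tensor_right B T a = tensor_rel B `` (image_mset (\<lambda>(x, y). (x, y * a)) ` T)"

definition tensor_mult :: "('a::{ring,monoid_mult} \<times> 'a) multiset set \<Rightarrow> 'a" where
  "tensor_mult T = the_elem ((\<lambda>M. \<Sum>(x, y)\<in>#M. x * y) ` T)"

lemma equiv_tensor_rel: "equiv UNIV (tensor_rel B)"
  by (rule equivI)
    (auto simp: tensor_rel_def refl_on_def sym_def trans_def intro: tensor_eq.intros)

lemma tensor_eq_neg: "tensor_eq B {#(x, y), (- x, y)#} {#}"
  using tensor_eq.add_left[of B x "- x" y] tensor_eq.zero[of B y]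
  by (metis add.right_inverse tensor_eq.sym tensor_eq.trans)

lemma tensor_eq_left:
  "tensor_eq B M N \<Longrightarrow>
   tensor_eq B (image_mset (\<lambda>(x, y). (a * x, y)) M) (image_mset (\<lambda>(x, y). (a * x, y)) N)"
proof (induction rule: tensor_eq.induct)
  case (balanced b x y)
  then show ?case using tensor_eq.balanced[of b B "a * x" y] by (simp add: mult.assoc)
qed (auto simp: distrib_left intro: tensor_eq.intros)

lemma tensor_eq_right:
  "tensor_eq B M N \<Longrightarrow>
   tensor_eq B (image_mset (\<lambda>(x, y). (x, y * a)) M) (image_mset (\<lambda>(x, y). (x, y * a)) N)"
proof (induction rule: tensor_eq.induct)
  case (balanced b x y)
  then show ?case using tensor_eq.balanced[of b B x "y * a"] by (simp add: mult.assoc)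
qed (auto simp: distrib_right intro: tensor_eq.intros)

lemma tensor_eq_mult: "tensor_eq B M N \<Longrightarrow> (\<Sum>(x, y)\<in>#M. x * y) = (\<Sum>(x, y)\<in>#N. x * y)"
  by (induction rule: tensor_eq.induct) (auto simp: algebra_simps)

lemma tensor_left_class:
  "tensor_left B a (tensor_rel B `` {M}) = tensor_rel B `` {image_mset (\<lambda>(x, y). (a * x, y)) M}"
  unfolding tensor_left_def tensor_rel_def
  using tensor_eq_left[of B _ _ a] by (auto intro: tensor_eq.intros)

lemma tensor_right_class:
  "tensor_right B (tensor_rel B `` {M}) a = tensor_rel B `` {image_mset (\<lambda>(x, y). (x, y * a)) M}"
  unfolding tensor_right_def tensor_rel_def
  using tensor_eq_right[of B _ _ a] by (auto intro: tensor_eq.intros)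

lemma tensor_mult_class: "tensor_mult (tensor_rel B `` {M}) = (\<Sum>(x, y)\<in>#M. x * y)"
proof -
  have "(\<lambda>M. \<Sum>(x, y)\<in>#M. x * y) ` (tensor_rel B `` {M}) = {\<Sum>(x, y)\<in>#M. x * y}"
    using tensor_eq_mult[of B M] by (auto simp: tensor_rel_def intro: tensor_eq.refl image_eqI[of _ _ M])
  then show ?thesis by (simp add: tensor_mult_def)
qed

definition separability_element ::
    "'a::{ring,monoid_mult} set \<Rightarrow> ('a \<times> 'a) multiset set \<Rightarrow> bool" where
  "separability_element B e \<longleftrightarrow>
     e \<in> tensor B \<and> (\<forall>a. tensor_left B a e = tensor_right B e a) \<and> tensor_mult e = 1"

section \<open>Frobenius extensions\<close>

definition center :: "'a::{ring,monoid_mult} set" where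
  "center = {z. \<forall>a. z * a = a * z}"

definition frobenius_system ::
    "'a::{ring,monoid_mult} set \<Rightarrow> ('a \<Rightarrow> 'a) \<Rightarrow> nat \<Rightarrow> (nat \<Rightarrow> 'a) \<Rightarrow> (nat \<Rightarrow> 'a) \<Rightarrow> bool" where
  "frobenius_system B E n x y \<longleftrightarrow>
     bimodule_hom B (*) (*) (*) (*) UNIV B E \<and>
     (\<forall>a. a = (\<Sum>i<n. E (a * x i) * y i) \<and> a = (\<Sum>i<n. x i * E (y i * a)))"

definition frobenius_index :: "nat \<Rightarrow> (nat \<Rightarrow> 'a::{ring,monoid_mult}) \<Rightarrow> (nat \<Rightarrow> 'a) \<Rightarrow> 'a" where
  "frobenius_index n x y = (\<Sum>i<n. x i * y i)"

definition uniquely_separable_frobenius :: "'a::{ring,monoid_mult} set \<Rightarrow> bool" where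
  "uniquely_separable_frobenius B \<longleftrightarrow>
     (\<exists>E n x y. frobenius_system B E n x y \<and>
        (\<exists>z\<in>center. frobenius_index n x y * z = 1 \<and> z * frobenius_index n x y = 1)) \<and>
     (\<exists>!e. separability_element B e)"

lemma frobenius_index_central:
  assumes "frobenius_system B E n x y"
  shows "frobenius_index n x y \<in> center"
proof -
  have r: "a = (\<Sum>i<n. E (a * x i) * y i)" and l: "a = (\<Sum>i<n. x i * E (y i * a))" for a
    using assms unfolding frobenius_system_def by blast+
  have "a * (\<Sum>i<n. x i * y i) = (\<Sum>j<n. x j * y j) * a" for a
  proof -
    have "a * (\<Sum>i<n. x i * y i) = (\<Sum>i<n. (\<Sum>j<n. x j * E (y j * (a * x i))) * y i)"
      unfolding l[symmetric] by (simp add: sum_distrib_left mult.assoc)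
    also have "\<dots> = (\<Sum>j<n. x j * (\<Sum>i<n. E ((y j * a) * x i) * y i))"
      unfolding sum_distrib_left sum_distrib_right
      by (subst sum.swap) (simp add: mult.assoc)
    also have "\<dots> = (\<Sum>j<n. x j * y j) * a"
      unfolding r[symmetric] by (simp add: sum_distrib_right mult.assoc)
    finally show ?thesis .
  qed
  then show ?thesis by (simp add: center_def frobenius_index_def)
qed

end

theory Submission
  imports Defs
begin

text \<open>
  Let \<open>A\<close> be the whole algebra and \<open>R\<close> the centralizer of \<open>B\<close> in \<open>A\<close>. The proof has two halves.

  Uniqueness of the separability element forces \<open>R\<close> to be the center of \<open>A\<close>. For every \<open>r \<in> R\<close>
  the tensor \<open>\<Sum>i. x i * r \<otimes> y i\<close> commutes with \<open>A\<close>, so its product \<open>\<Sum>i. x i * r * y i\<close> is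
  central. If this product is zero, adding the tensor to the separability element gives another
  one, so the tensor vanishes, and then \<open>r = 0\<close> (\<open>casimir_map_injective\<close>). Hence
  \<open>r \<mapsto> \<Sum>i. x i * r * y i\<close> is an injective linear map of the finite-dimensional space \<open>R\<close> into
  the center, which is contained in \<open>R\<close>; it is therefore onto \<open>R\<close>, and \<open>R\<close> equals the center
  (\<open>centralizer_subset_center\<close>).

  Once the center of \<open>B\<close> is central in \<open>A\<close>, semisimplicity of \<open>B\<close> gives \<open>A = B R\<close>. With matrix
  units this is the classical splitting of \<open>A\<close> over each matrix block of \<open>B\<close>; here the
  Wedderburn decomposition is replaced by the trace form of the regular representation of \<open>B\<close>.
  The form is nondegenerate, because its radical would be generated by an idempotent of trace
  zero. For dual bases \<open>b\<close>, \<open>dual b\<close> of it, \<open>average a = \<Sum>b. b * a * dual b\<close> is a projection of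
  \<open>A\<close> onto \<open>R\<close>, and
  \<open>(\<Sum>b. b * average (dual b * a)) = (\<Sum>b. \<Sum>c. b * c * dual b * a * dual c) =
  (\<Sum>c. average c * a * dual c) = a * weight\<close>,
  since \<open>average c\<close> lies in the center of \<open>B\<close> (\<open>sum_basis_average\<close>). On a block of \<open>d \<times> d\<close>
  matrices the element \<open>weight\<close> is the scalar \<open>1 / d\<^sup>2\<close>; in general it is invertible in \<open>B\<close>
  (\<open>weight_invertible\<close>), whence \<open>A = B R\<close>.

  Writing the elements \<open>x i\<close> of a Frobenius dual basis in this form and averaging the
  resulting expansion of \<open>a\<close> yields \<open>a = \<Sum>k. E (s k * a) * r k\<close> with all \<open>r k\<close> and \<open>s k\<close> in
  \<open>R\<close>. The maps \<open>a \<mapsto> E (s k * a)\<close> and \<open>b \<mapsto> b * r k\<close> are bimodule homomorphisms, so the identity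
  of \<open>A\<close> factors through a finite direct sum of copies of \<open>B\<close>, which is depth one
  (\<open>depth_oneI\<close>, \<open>depth_one_if_central\<close>).
\<close>

section \<open>Traces on subspaces\<close>

context finite_dimensional_vector_space
begin

definition basis_of :: "'b set \<Rightarrow> 'b set" where
  "basis_of V = (SOME S. S \<subseteq> V \<and> independent S \<and> V \<subseteq> span S)"

lemma basis_of: "basis_of V \<subseteq> V" "independent (basis_of V)" "V \<subseteq> span (basis_of V)"
proof -
  have "\<exists>S. S \<subseteq> V \<and> independent S \<and> V \<subseteq> span S"
    by (rule basis_exists[of V]) blast
  from someI_ex[OF this]
  show "basis_of V \<subseteq> V" "independent (basis_of V)" "V \<subseteq> span (basis_of V)"
    by (auto simp: basis_of_def)
qed

lemma finite_basis_of: "finite (basis_of V)"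
  using basis_of(2) by (rule finiteI_independent)

lemma expand_in_basis_of:
  assumes "v \<in> V"
  shows "v = (\<Sum>b\<in>basis_of V. scale (representation (basis_of V) v b) b)"
  using sum_representation_eq[OF basis_of(2) _ finite_basis_of order_refl, of v] assms basis_of(3)
  by (metis subsetD)

definition trace_on :: "'b set \<Rightarrow> ('b \<Rightarrow> 'b) \<Rightarrow> 'a" where
  "trace_on V f = (\<Sum>b\<in>basis_of V. representation (basis_of V) (f b) b)"

lemma representation_expand:
  assumes "Vector_Spaces.linear scale scale f" "f ` V \<subseteq> W" "v \<in> V"
  shows "representation (basis_of W) (f v) c =
    (\<Sum>b\<in>basis_of V. representation (basis_of V) v b * representation (basis_of W) (f b) c)"
proof -
  interpret f: Vector_Spaces.linear scale scale f by fact
  have in_span: "f b \<in> span (basis_of W)" if "b \<in> basis_of V" for b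
    using that assms(2) basis_of[of V] basis_of[of W] by blast
  have "f v = (\<Sum>b\<in>basis_of V. scale (representation (basis_of V) v b) (f b))"
    by (subst expand_in_basis_of[OF assms(3)]) (simp only: f.sum f.scale)
  then show ?thesis
    using in_span basis_of(2)[of W]
    by (simp add: representation_sum representation_scale span_scale)
qed

text \<open>Besides the symmetry of the trace form, where \<open>V = W\<close>, this covers the factorization of an
  idempotent of \<open>V\<close> through its image \<open>W\<close>.\<close>

lemma trace_on_commute:
  assumes f: "Vector_Spaces.linear scale scale f" "f ` V \<subseteq> W"
    and g: "Vector_Spaces.linear scale scale g" "g ` W \<subseteq> V"
  shows "trace_on V (\<lambda>v. g (f v)) = trace_on W (\<lambda>w. f (g w))"
proof -
  let ?r = "representation (basis_of V)" and ?s = "representation (basis_of W)"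
  have "trace_on V (\<lambda>v. g (f v)) =
      (\<Sum>b\<in>basis_of V. \<Sum>c\<in>basis_of W. ?s (f b) c * ?r (g c) b)"
    unfolding trace_on_def
  proof (rule sum.cong[OF HOL.refl])
    fix b assume "b \<in> basis_of V"
    then have "f b \<in> W" using f(2) basis_of(1) by blast
    then show "?r (g (f b)) b = (\<Sum>c\<in>basis_of W. ?s (f b) c * ?r (g c) b)"
      by (rule representation_expand[OF g])
  qed
  also have "\<dots> = (\<Sum>c\<in>basis_of W. \<Sum>b\<in>basis_of V. ?r (g c) b * ?s (f b) c)"
    by (subst sum.swap) (simp add: mult.commute)
  also have "\<dots> = trace_on W (\<lambda>w. f (g w))"
    unfolding trace_on_def
  proof (rule sum.cong[OF HOL.refl])
    fix c assume "c \<in> basis_of W"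
    then have "g c \<in> V" using g(2) basis_of(1) by blast
    then show "(\<Sum>b\<in>basis_of V. ?r (g c) b * ?s (f b) c) = ?s (f (g c)) c"
      using representation_expand[OF f] by simp
  qed
  finally show ?thesis .
qed

end

locale fd_complex_algebra = complex_algebra scale + finite_dimensional_vector_space scale Basis
  for scale :: "complex \<Rightarrow> 'a::{ring,monoid_mult} \<Rightarrow> 'a" and Basis :: "'a set"
begin

text \<open>In characteristic zero the trace of an idempotent, being its rank, detects whether the
  idempotent vanishes: factoring it through its image, where it is the identity, turns the trace
  into the size of a basis of the image.\<close>

lemma idempotent_trace_zero:
  assumes V: "subspace V" and p: "Vector_Spaces.linear scale scale p" "p ` V \<subseteq> V"
    and idem: "\<And>v. v \<in> V \<Longrightarrow> p (p v) = p v" and tr: "trace_on V p = 0" and "v \<in> V"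
  shows "p v = 0"
proof -
  interpret p: Vector_Spaces.linear scale scale p by fact
  let ?W = "p ` V"
  have fixed: "p c = c" if "c \<in> basis_of ?W" for c
    using that basis_of(1)[of ?W] idem by blast
  have "trace_on V p = trace_on ?W p"
    using trace_on_commute[OF p(1) order_refl, of "\<lambda>x. x" V] p(2) linear_id
    by (simp add: id_def)
  also have "\<dots> = (\<Sum>c\<in>basis_of ?W. 1)"
    unfolding trace_on_def using basis_of(2)
    by (intro sum.cong) (auto simp: fixed representation_basis)
  also have "\<dots> = of_nat (card (basis_of ?W))" by simp
  finally have "basis_of ?W = {}"
    using tr finite_basis_of by simp
  then have "?W \<subseteq> {0}" using basis_of(3)[of ?W] by simp
  then show ?thesis using \<open>v \<in> V\<close> by blast
qed

lemma linear_mult_left: "Vector_Spaces.linear scale scale (\<lambda>y. x * y)"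
  by (simp add: Vector_Spaces.linear_iff vector_space_axioms distrib_left scale_mult_right)

lemma linear_mult_right: "Vector_Spaces.linear scale scale (\<lambda>y. y * x)"
  by (simp add: Vector_Spaces.linear_iff vector_space_axioms distrib_right scale_mult_left)

lemma linear_sum_maps:
  assumes "\<And>i. i \<in> I \<Longrightarrow> Vector_Spaces.linear scale scale (f i)"
  shows "Vector_Spaces.linear scale scale (\<lambda>v. \<Sum>i\<in>I. f i v)"
  using assms by (simp add: Vector_Spaces.linear_iff vector_space_axioms sum.distrib scale_sum_right)

lemma linear_injective_onto:
  assumes V: "subspace V" and f: "Vector_Spaces.linear scale scale f" "f ` V \<subseteq> V"
    and inj: "\<And>v. v \<in> V \<Longrightarrow> f v = 0 \<Longrightarrow> v = 0"
  shows "f ` V = V"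
proof -
  interpret f: Vector_Spaces.linear scale scale f by fact
  interpret pair: finite_dimensional_vector_space_pair_1 scale Basis scale ..
  have sp: "span V = V" using V by (simp add: span_eq_iff)
  have "inj_on f (span V)"
    unfolding sp
  proof (rule inj_onI)
    fix u v assume "u \<in> V" "v \<in> V" "f u = f v"
    then show "u = v" using inj[of "u - v"] V by (simp add: f.diff subspace_diff)
  qed
  then have "dim (f ` V) = dim V" by (rule pair.dim_image_eq[OF f(1)])
  moreover have "subspace (f ` V)" using V by (rule f.subspace_image)
  ultimately show ?thesis using V f(2) by (intro subspace_dim_equal) auto
qed

end

section \<open>The trace form of a semisimple subalgebra\<close>

locale semisimple_subalgebra = fd_complex_algebra scale Basis
  for scale :: "complex \<Rightarrow> 'a::{ring,monoid_mult} \<Rightarrow> 'a" and Basis :: "'a set" +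
  fixes B :: "'a set"
  assumes subalgebra: "unital_subalgebra B"
    and semisimple: "semisimple B"
begin

lemma subspace_B: "subspace B"
  and one_B [simp]: "1 \<in> B"
  and mult_B [simp]: "x \<in> B \<Longrightarrow> y \<in> B \<Longrightarrow> x * y \<in> B"
  using subalgebra by (auto simp: unital_subalgebra_def)

lemma zero_B [simp]: "0 \<in> B"
  and diff_B [simp]: "x \<in> B \<Longrightarrow> y \<in> B \<Longrightarrow> x - y \<in> B"
  and scale_B [simp]: "x \<in> B \<Longrightarrow> scale c x \<in> B"
  and sum_B [simp]: "(\<And>i. i \<in> I \<Longrightarrow> f i \<in> B) \<Longrightarrow> sum f I \<in> B"
  using subspace_B by (auto simp: subspace_0 subspace_diff subspace_scale subspace_sum)

text \<open>Split \<open>1 = f + e\<close> along the ideal and a complement. For \<open>x\<close> in the ideal,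
  \<open>x * e = x - x * f\<close> lies in both summands and is zero.\<close>

lemma left_ideal_right_identity:
  assumes "left_ideal B I"
  obtains f where "f \<in> I" "\<And>x. x \<in> I \<Longrightarrow> x * f = x"
proof -
  obtain J where J: "left_ideal B J" and "direct_sum B I J"
    using semisimple assms unfolding semisimple_def by blast
  then have sum: "B = {u + v |u v. u \<in> I \<and> v \<in> J}" and int: "I \<inter> J = {0}"
    by (auto simp: direct_sum_def)
  obtain f e where fe: "1 = f + e" "f \<in> I" "e \<in> J"
    using one_B sum by blast
  have "x * f = x" if x: "x \<in> I" for x
  proof -
    have "x = x * f + x * e" using fe(1) by (metis distrib_left mult_1_right)
    then have "x * e = x - x * f" by (metis add_diff_cancel_left')
    moreover have "x \<in> B" using assms x by (auto simp: left_ideal_def)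
    then have "x - x * f \<in> I" "x * e \<in> J"
      using assms x J fe by (auto simp: left_ideal_def)
    ultimately have "x * e \<in> I \<inter> J" by simp
    then have "x * e = 0" using int by blast
    then show ?thesis using \<open>x = x * f + x * e\<close> by simp
  qed
  with fe(2) show thesis by (rule that)
qed

text \<open>The trace of the regular representation of \<open>B\<close>, as a linear functional on \<open>B\<close>; the trace
  form is \<open>(x, y) \<mapsto> form (x * y)\<close>.\<close>

definition form :: "'a \<Rightarrow> complex" where
  "form x = trace_on B (\<lambda>y. x * y)"

lemma representation_add_B:
  "u \<in> B \<Longrightarrow> v \<in> B \<Longrightarrow>
   representation (basis_of B) (u + v) b =
   representation (basis_of B) u b + representation (basis_of B) v b"
  using basis_of[of B] by (subst representation_add) auto

lemma representation_scale_B: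
  "u \<in> B \<Longrightarrow> representation (basis_of B) (scale c u) b = c * representation (basis_of B) u b"
  using basis_of[of B] by (subst representation_scale) auto

lemma basis_B [simp]: "b \<in> basis_of B \<Longrightarrow> b \<in> B"
  using basis_of(1) by blast

lemma form_add: "x \<in> B \<Longrightarrow> y \<in> B \<Longrightarrow> form (x + y) = form x + form y"
  by (simp add: form_def trace_on_def distrib_right representation_add_B sum.distrib)

lemma form_scale: "x \<in> B \<Longrightarrow> form (scale c x) = c * form x"
  by (simp add: form_def trace_on_def scale_mult_left[symmetric] representation_scale_B
      sum_distrib_left)

lemma form_zero [simp]: "form 0 = 0"
  using form_scale[of 0 0] by simp

lemma form_sum: "(\<And>i. i \<in> I \<Longrightarrow> f i \<in> B) \<Longrightarrow> form (sum f I) = (\<Sum>i\<in>I. form (f i))"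
  by (induction I rule: infinite_finite_induct) (auto simp: form_add)

lemma form_diff: "x \<in> B \<Longrightarrow> y \<in> B \<Longrightarrow> form (x - y) = form x - form y"
  using form_add[of "x - y" y] by simp

lemma form_commute: "x \<in> B \<Longrightarrow> y \<in> B \<Longrightarrow> form (x * y) = form (y * x)"
  unfolding form_def mult.assoc
  by (intro trace_on_commute linear_mult_left) auto

text \<open>The radical of the trace form is a left ideal. Its right identity is an idempotent of trace
  zero, hence zero.\<close>

lemma form_nondegenerate:
  assumes "x \<in> B" and "\<And>y. y \<in> B \<Longrightarrow> form (x * y) = 0"
  shows "x = 0"
proof -
  define I where "I = {x \<in> B. \<forall>y\<in>B. form (x * y) = 0}"
  have "left_ideal B I"
    unfolding left_ideal_def
  proof (intro conjI ballI)
    fix r u assume ru: "r \<in> B" "u \<in> I"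
    have "form (r * u * y) = 0" if "y \<in> B" for y
      using ru that form_commute[of r "u * y"] by (simp add: I_def mult.assoc)
    then show "r * u \<in> I" using ru by (simp add: I_def)
  qed (auto simp: I_def left_diff_distrib form_diff)
  then obtain f where f: "f \<in> I" "\<And>x. x \<in> I \<Longrightarrow> x * f = x"
    by (rule left_ideal_right_identity) blast
  have fB: "f \<in> B" using f(1) by (simp add: I_def)
  have "form (f * 1) = 0" using f(1) one_B unfolding I_def by blast
  then have "trace_on B (\<lambda>y. f * y) = 0" by (simp add: form_def)
  then have "f * 1 = 0"
    using f fB
    by (intro idempotent_trace_zero[OF subspace_B linear_mult_left]) (auto simp flip: mult.assoc)
  then have "f = 0" by simp
  moreover have "x \<in> I" using assms by (simp add: I_def)
  ultimately show ?thesis using f(2) by fastforce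
qed

text \<open>By nondegeneracy the map \<open>H\<close>, which lists the values of \<open>form (x * _)\<close> on the basis as
  coordinates, is injective on \<open>B\<close>, hence onto.\<close>

lemma dual_basis_exists:
  assumes "b \<in> basis_of B"
  shows "\<exists>d\<in>B. \<forall>c\<in>basis_of B. form (d * c) = (if c = b then 1 else 0)"
proof -
  interpret pair: vector_space_pair scale scale ..
  let ?S = "basis_of B" and ?R = "representation (basis_of B)"
  define H where "H x = (\<Sum>c\<in>?S. scale (form (x * c)) c)" for x
  have coord: "form (x * c) = 0" if "c \<in> ?S" "H x = 0" for x c
    using independentD[OF basis_of(2) finite_basis_of order_refl,
        where u = "\<lambda>c. form (x * c)"] that
    by (simp add: H_def)
  have H_B: "H x \<in> B" for x by (simp add: H_def)
  have H_0: "H 0 = 0" by (simp add: H_def)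
  have H_add: "H (x + y) = H x + H y" if "x \<in> B" "y \<in> B" for x y
    using that by (simp add: H_def distrib_right form_add scale_left_distrib sum.distrib)
  have H_scale: "H (scale k x) = scale k (H x)" if "x \<in> B" for x k
    using that by (simp add: H_def scale_mult_left[symmetric] form_scale scale_sum_right)
  have H_sum: "H (sum f I) = (\<Sum>i\<in>I. H (f i))" if "\<And>i. i \<in> I \<Longrightarrow> f i \<in> B" for f :: "'a \<Rightarrow> 'a" and I
    using that by (induction I rule: infinite_finite_induct) (auto simp: H_add H_0)
  \<comment> \<open>The trace form is linear only on \<open>B\<close>, so \<open>H\<close> is replaced by a linear map on the whole
    algebra that agrees with it on \<open>B\<close>.\<close>
  obtain g where g: "Vector_Spaces.linear scale scale g" "\<And>c. c \<in> ?S \<Longrightarrow> g c = H c"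
    using pair.linear_independent_extend[OF basis_of(2)] by blast
  interpret g: Vector_Spaces.linear scale scale g by fact
  have gH: "g x = H x" if "x \<in> B" for x
  proof -
    have "g x = (\<Sum>c\<in>?S. scale (?R x c) (g c))"
      by (subst expand_in_basis_of[OF that]) (simp only: g.sum g.scale)
    also have "\<dots> = H (\<Sum>c\<in>?S. scale (?R x c) c)"
      by (simp add: H_sum H_scale g(2))
    finally show ?thesis by (simp flip: expand_in_basis_of[OF that])
  qed
  have "g ` B = B"
  proof (rule linear_injective_onto[OF subspace_B g(1)])
    fix x assume x: "x \<in> B" "g x = 0"
    have "form (x * y) = 0" if y: "y \<in> B" for y
    proof -
      have "x * y = (\<Sum>c\<in>?S. scale (?R y c) (x * c))"
        by (subst expand_in_basis_of[OF y]) (simp add: sum_distrib_left scale_mult_right)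
      then show ?thesis using x coord by (simp add: form_sum form_scale gH)
    qed
    then show "x = 0" using x(1) form_nondegenerate by blast
  qed (auto simp: gH H_B)
  then obtain d where d: "d \<in> B" "H d = b"
    using assms by (metis basis_B gH imageE)
  have "form (d * c) = (if c = b then 1 else 0)" if c: "c \<in> ?S" for c
  proof -
    have "?R (H d) c = (\<Sum>i\<in>?S. form (d * i) * ?R i c)"
      unfolding H_def using basis_of(2)[of B]
      by (subst representation_sum) (auto simp: representation_scale span_base span_scale)
    also have "\<dots> = (\<Sum>i\<in>?S. if i = c then form (d * i) else 0)"
      using basis_of(2)[of B] by (intro sum.cong) (auto simp: representation_basis)
    also have "\<dots> = form (d * c)" using c finite_basis_of[of B] by simp
    finally show ?thesis using assms d(2) basis_of(2)[of B] by (simp add: representation_basis)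
  qed
  then show ?thesis using d(1) by blast
qed

definition dual :: "'a \<Rightarrow> 'a" where
  "dual b = (SOME d. d \<in> B \<and> (\<forall>c\<in>basis_of B. form (d * c) = (if c = b then 1 else 0)))"

lemma dual:
  assumes "b \<in> basis_of B"
  shows dual_B [simp]: "dual b \<in> B"
    and form_dual: "c \<in> basis_of B \<Longrightarrow> form (dual b * c) = (if c = b then 1 else 0)"
proof -
  have "\<exists>d. d \<in> B \<and> (\<forall>c\<in>basis_of B. form (d * c) = (if c = b then 1 else 0))"
    using dual_basis_exists[OF assms] by blast
  from someI_ex[OF this]
  show "dual b \<in> B" "c \<in> basis_of B \<Longrightarrow> form (dual b * c) = (if c = b then 1 else 0)"
    by (auto simp: dual_def)
qed

lemma representation_eq_form:
  assumes "b \<in> basis_of B" "x \<in> B"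
  shows "representation (basis_of B) x b = form (dual b * x)"
proof -
  let ?R = "representation (basis_of B)"
  have "dual b * x = (\<Sum>c\<in>basis_of B. scale (?R x c) (dual b * c))"
    by (subst expand_in_basis_of[OF assms(2)]) (simp add: sum_distrib_left scale_mult_right)
  then have "form (dual b * x) = (\<Sum>c\<in>basis_of B. if c = b then ?R x c else 0)"
    using assms by (simp add: form_sum form_scale form_dual if_distrib cong: if_cong)
  then show ?thesis using assms finite_basis_of[of B] by simp
qed

lemma expand_in_basis:
  assumes "x \<in> B"
  shows "x = (\<Sum>b\<in>basis_of B. scale (form (dual b * x)) b)"
  by (subst expand_in_basis_of[OF assms]) (simp add: representation_eq_form assms)

lemma expand_in_dual_basis:
  assumes "x \<in> B"
  shows "x = (\<Sum>b\<in>basis_of B. scale (form (x * b)) (dual b))"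
proof -
  define d where "d = x - (\<Sum>b\<in>basis_of B. scale (form (x * b)) (dual b))"
  have d: "d \<in> B" using assms by (simp add: d_def)
  have on_basis: "form (d * c) = 0" if c: "c \<in> basis_of B" for c
  proof -
    have "d * c = x * c - (\<Sum>b\<in>basis_of B. scale (form (x * b)) (dual b * c))"
      by (simp add: d_def left_diff_distrib sum_distrib_right scale_mult_left)
    also have "form \<dots> = form (x * c) - (\<Sum>b\<in>basis_of B. if b = c then form (x * b) else 0)"
      using assms c
      by (simp add: form_diff form_sum form_scale form_dual if_distrib eq_commute cong: if_cong)
    finally show ?thesis using c finite_basis_of[of B] by simp
  qed
  have "form (d * y) = 0" if y: "y \<in> B" for y
  proof -
    have "d * y = (\<Sum>c\<in>basis_of B. scale (form (dual c * y)) (d * c))"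
      by (subst expand_in_basis[OF y]) (simp only: sum_distrib_left scale_mult_right)
    then show ?thesis using d by (simp add: form_sum form_scale on_basis)
  qed
  then show ?thesis using form_nondegenerate[OF d] by (simp add: d_def)
qed


section \<open>The Casimir element and averaging over the subalgebra\<close>

text \<open>The next two lemmas state the identities \<open>\<Sum>b. x * b \<otimes> dual b = \<Sum>b. b \<otimes> dual b * x\<close> and
  \<open>\<Sum>b. b * x \<otimes> dual b = \<Sum>b. b \<otimes> x * dual b\<close>, evaluated under a bilinear map \<open>F\<close>. Both sides
  have the same coefficients in terms of \<open>F c (dual b)\<close>; for the second identity this uses that
  \<open>form\<close> is a trace.\<close>

lemma casimir_shift:
  assumes F: "\<And>u. Vector_Spaces.linear scale scale (F u)"
      "\<And>v. Vector_Spaces.linear scale scale (\<lambda>u. F u v)"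
    and x: "x \<in> B"
  shows "(\<Sum>b\<in>basis_of B. F (x * b) (dual b)) = (\<Sum>b\<in>basis_of B. F b (dual b * x))"
proof -
  have "(\<Sum>b\<in>basis_of B. F (x * b) (dual b)) =
      (\<Sum>b\<in>basis_of B. \<Sum>c\<in>basis_of B. scale (form (dual c * x * b)) (F c (dual b)))"
  proof (rule sum.cong[OF HOL.refl])
    fix b assume b: "b \<in> basis_of B"
    interpret f: Vector_Spaces.linear scale scale "\<lambda>u. F u (dual b)" by (rule F)
    have "x * b = (\<Sum>c\<in>basis_of B. scale (form (dual c * x * b)) c)"
      using b x by (subst expand_in_basis[of "x * b"]) (simp_all add: mult.assoc)
    then show "F (x * b) (dual b) = (\<Sum>c\<in>basis_of B. scale (form (dual c * x * b)) (F c (dual b)))"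
      by (simp only: f.sum f.scale)
  qed
  also have "\<dots> = (\<Sum>c\<in>basis_of B. \<Sum>b\<in>basis_of B. scale (form (dual c * x * b)) (F c (dual b)))"
    by (rule sum.swap)
  also have "\<dots> = (\<Sum>c\<in>basis_of B. F c (dual c * x))"
  proof (rule sum.cong[OF HOL.refl])
    fix c assume c: "c \<in> basis_of B"
    interpret f: Vector_Spaces.linear scale scale "F c" by (rule F)
    have "dual c * x = (\<Sum>b\<in>basis_of B. scale (form (dual c * x * b)) (dual b))"
      using c x by (intro expand_in_dual_basis) simp
    from arg_cong[OF this, of "F c"]
    show "(\<Sum>b\<in>basis_of B. scale (form (dual c * x * b)) (F c (dual b))) = F c (dual c * x)"
      by (simp only: f.sum f.scale)
  qed
  finally show ?thesis .
qed

lemma casimir_inner: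
  assumes F: "\<And>u. Vector_Spaces.linear scale scale (F u)"
      "\<And>v. Vector_Spaces.linear scale scale (\<lambda>u. F u v)"
    and x: "x \<in> B"
  shows "(\<Sum>b\<in>basis_of B. F (b * x) (dual b)) = (\<Sum>b\<in>basis_of B. F b (x * dual b))"
proof -
  have "(\<Sum>b\<in>basis_of B. F (b * x) (dual b)) =
      (\<Sum>b\<in>basis_of B. \<Sum>c\<in>basis_of B. scale (form (dual c * b * x)) (F c (dual b)))"
  proof (rule sum.cong[OF HOL.refl])
    fix b assume b: "b \<in> basis_of B"
    interpret f: Vector_Spaces.linear scale scale "\<lambda>u. F u (dual b)" by (rule F)
    have "b * x = (\<Sum>c\<in>basis_of B. scale (form (dual c * b * x)) c)"
      using b x by (subst expand_in_basis[of "b * x"]) (simp_all add: mult.assoc)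
    then show "F (b * x) (dual b) = (\<Sum>c\<in>basis_of B. scale (form (dual c * b * x)) (F c (dual b)))"
      by (simp only: f.sum f.scale)
  qed
  also have "\<dots> = (\<Sum>c\<in>basis_of B. \<Sum>b\<in>basis_of B. scale (form (dual c * b * x)) (F c (dual b)))"
    by (rule sum.swap)
  also have "\<dots> = (\<Sum>c\<in>basis_of B. F c (x * dual c))"
  proof (rule sum.cong[OF HOL.refl])
    fix c assume c: "c \<in> basis_of B"
    interpret f: Vector_Spaces.linear scale scale "F c" by (rule F)
    have "x * dual c = (\<Sum>b\<in>basis_of B. scale (form (x * dual c * b)) (dual b))"
      using c x by (intro expand_in_dual_basis) simp
    also have "\<dots> = (\<Sum>b\<in>basis_of B. scale (form (dual c * b * x)) (dual b))"
      using c x form_commute[of x] by (intro sum.cong) (simp_all add: mult.assoc)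
    finally show "(\<Sum>b\<in>basis_of B. scale (form (dual c * b * x)) (F c (dual b))) = F c (x * dual c)"
      by (simp only: f.sum f.scale)
  qed
  finally show ?thesis .
qed

definition average :: "'a \<Rightarrow> 'a" where
  "average a = (\<Sum>b\<in>basis_of B. b * a * dual b)"

lemma linear_mult_both: "Vector_Spaces.linear scale scale (\<lambda>y. u * y * v)"
  by (simp add: Vector_Spaces.linear_iff vector_space_axioms distrib_left distrib_right
      scale_mult_left scale_mult_right flip: scale_mult_left scale_mult_right)

lemma linear_average: "Vector_Spaces.linear scale scale average"
  unfolding average_def by (intro linear_sum_maps linear_mult_both)

lemma average_B [simp]: "x \<in> B \<Longrightarrow> average x \<in> B"
  by (simp add: average_def)

lemma average_commute:
  assumes "x \<in> B"
  shows "x * average a = average a * x"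
  using casimir_shift[of "\<lambda>u v. u * a * v", OF linear_mult_left _ assms]
    linear_mult_right[of "a * _"]
  by (simp add: average_def sum_distrib_left sum_distrib_right mult.assoc)

lemma average_mult_swap:
  assumes "x \<in> B"
  shows "average (x * a) = average (a * x)"
  using casimir_inner[of "\<lambda>u v. u * a * v", OF linear_mult_left _ assms]
    linear_mult_right[of "a * _"]
  by (simp add: average_def mult.assoc)

text \<open>Pairing \<open>average 1\<close> with \<open>y\<close> computes the trace of left multiplication by \<open>y\<close> in the dual
  bases, which is \<open>form y\<close>; nondegeneracy concludes.\<close>

lemma average_one: "average 1 = 1"
proof -
  define c where "c = average 1"
  have c: "c \<in> B" by (simp add: c_def)
  have "form ((c - 1) * y) = 0" if y: "y \<in> B" for y
  proof -
    have "form (y * c) = (\<Sum>b\<in>basis_of B. form (y * b * dual b))"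
      using y by (simp add: c_def average_def sum_distrib_left form_sum mult.assoc)
    also have "\<dots> = (\<Sum>b\<in>basis_of B. representation (basis_of B) (y * b) b)"
      using y by (intro sum.cong) (simp_all add: representation_eq_form form_commute)
    also have "\<dots> = form y" by (simp add: form_def trace_on_def)
    finally show ?thesis
      using y c form_commute[of c y] by (simp add: left_diff_distrib form_diff)
  qed
  then show ?thesis using form_nondegenerate[of "c - 1"] c by (simp add: c_def)
qed

lemma average_mult_centralizing:
  assumes "\<And>b. b \<in> B \<Longrightarrow> b * r = r * b"
  shows "average (r * a) = r * average a"
  using assms by (simp add: average_def sum_distrib_left flip: mult.assoc)

lemma average_centralizing:
  assumes "\<And>b. b \<in> B \<Longrightarrow> b * r = r * b"
  shows "average r = r"
  using average_mult_centralizing[of r 1] assms average_one by simp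

text \<open>The scalar \<open>1 / d\<^sup>2\<close> on each block of \<open>d \<times> d\<close> matrices.\<close>

definition weight :: 'a where
  "weight = (\<Sum>b\<in>basis_of B. average b * dual b)"

lemma weight_B [simp]: "weight \<in> B"
  by (simp add: weight_def)

lemma weight_commute:
  assumes x: "x \<in> B"
  shows "x * weight = weight * x"
proof -
  interpret avg: Vector_Spaces.linear scale scale average by (rule linear_average)
  have lin: "Vector_Spaces.linear scale scale (\<lambda>u. average u * v)" for v
    by (simp add: Vector_Spaces.linear_iff vector_space_axioms avg.add avg.scale
        distrib_right scale_mult_left)
  have "x * weight = (\<Sum>b\<in>basis_of B. average b * (x * dual b))"
    using average_commute[OF x]
    by (simp add: weight_def sum_distrib_left flip: mult.assoc)
  also have "\<dots> = (\<Sum>b\<in>basis_of B. average (x * b) * dual b)"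
    using casimir_inner[of "\<lambda>u v. average u * v", OF linear_mult_left lin x]
      average_mult_swap[OF x] by simp
  also have "\<dots> = weight * x"
    using casimir_shift[of "\<lambda>u v. average u * v", OF linear_mult_left lin x]
    by (simp add: weight_def sum_distrib_right mult.assoc)
  finally show ?thesis .
qed

text \<open>For \<open>x\<close> in the center of \<open>B\<close> this is the trace of multiplication by \<open>x\<close> on the center,
  because \<open>average\<close> projects \<open>B\<close> onto its center.\<close>

lemma form_weight:
  assumes "x \<in> B"
  shows "form (x * weight) = trace_on B (\<lambda>y. x * average y)"
proof -
  have "form (x * weight) = (\<Sum>b\<in>basis_of B. form (x * average b * dual b))"
    using assms by (simp add: weight_def sum_distrib_left form_sum mult.assoc)
  also have "\<dots> = trace_on B (\<lambda>y. x * average y)"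
    unfolding trace_on_def using assms
    by (intro sum.cong) (simp_all add: representation_eq_form form_commute)
  finally show ?thesis .
qed

text \<open>Since \<open>weight\<close> is central in \<open>B\<close>, it generates a two-sided ideal, and the right identity \<open>f\<close>
  of that ideal is central by nondegeneracy. The complementary central idempotent \<open>e\<close> annihilates
  \<open>weight\<close>, so that \<open>y \<mapsto> e * average y\<close> is an idempotent map of trace
  \<open>form (e * weight) = 0\<close>. It vanishes at \<open>1\<close>, which means \<open>e = 0\<close>.\<close>

lemma weight_invertible: "\<exists>u\<in>B. u * weight = 1"
proof -
  let ?I = "(\<lambda>b. b * weight) ` B"
  have "left_ideal B ?I"
    unfolding left_ideal_def
  proof (intro conjI ballI)
    show "0 \<in> ?I" by (rule image_eqI[of _ _ 0]) auto
    show "u - v \<in> ?I" if "u \<in> ?I" "v \<in> ?I" for u v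
      using that by (auto simp flip: left_diff_distrib)
    show "r * u \<in> ?I" if "r \<in> B" "u \<in> ?I" for r u
      using that by (auto simp flip: mult.assoc)
  qed auto
  then obtain f where f: "f \<in> ?I" "\<And>x. x \<in> ?I \<Longrightarrow> x * f = x"
    by (rule left_ideal_right_identity) blast
  obtain u where u: "u \<in> B" "f = u * weight" using f(1) by blast
  have fB: "f \<in> B" using u by simp
  have ff: "f * f = f" using f by blast
  have fxf: "f * x * f = f * x" if x: "x \<in> B" for x
  proof -
    have "f * x = u * x * weight"
      using weight_commute[OF x] by (simp add: u(2) mult.assoc)
    then have "f * x \<in> ?I" using u(1) x by (intro image_eqI[of _ _ "u * x"]) auto
    then show ?thesis by (rule f(2))
  qed
  \<comment> \<open>The commutator \<open>n\<close> satisfies \<open>f * n = 0\<close> and \<open>n * f = n\<close>, which puts it in the radical of the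
    trace form.\<close>
  have f_central: "x * f = f * x" if x: "x \<in> B" for x
  proof -
    define n where "n = x * f - f * x"
    have n: "n \<in> B" using x fB by (simp add: n_def)
    have fn: "f * n = 0" and nf: "n * f = n"
      using fxf[OF x] ff by (simp_all add: n_def left_diff_distrib right_diff_distrib mult.assoc)
        (simp flip: mult.assoc)
    have "form (n * y) = 0" if y: "y \<in> B" for y
    proof -
      have "form (n * y) = form (n * (f * y))" using nf by (simp flip: mult.assoc)
      also have "\<dots> = form (f * y * n)" using n y fB by (intro form_commute) auto
      also have "f * y * n = f * y * f * n" using fxf[OF y] by simp
      also have "\<dots> = 0" using fn by (simp add: mult.assoc)
      finally show ?thesis by simp
    qed
    then have "n = 0" using form_nondegenerate[OF n] by blast
    then show ?thesis by (simp add: n_def)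
  qed
  define e where "e = 1 - f"
  have eB: "e \<in> B" and ee: "e * e = e"
    using fB ff by (simp_all add: e_def left_diff_distrib right_diff_distrib)
  have e_central: "x * e = e * x" if "x \<in> B" for x
    using f_central[OF that] by (simp add: e_def left_diff_distrib right_diff_distrib)
  have "weight \<in> ?I" by (rule image_eqI[of _ _ 1]) auto
  then have "weight * f = weight" by (rule f(2))
  then have "e * weight = 0"
    using fB f_central[of weight] by (simp add: e_def left_diff_distrib)
  then have "trace_on B (\<lambda>y. e * average y) = 0"
    using form_weight[OF eB] by simp
  moreover have "Vector_Spaces.linear scale scale (\<lambda>y. e * average y)"
    using Vector_Spaces.linear_compose[OF linear_average linear_mult_left[of e]]
    by (simp add: o_def)
  moreover have "e * average (e * average y) = e * average y" if "y \<in> B" for y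
  proof -
    have "average (e * average y) = e * average y"
      by (rule average_centralizing)
        (metis average_commute e_central mult.assoc)
    then show ?thesis using ee by (simp flip: mult.assoc)
  qed
  ultimately have "e * average 1 = 0"
    using eB by (intro idempotent_trace_zero[OF subspace_B, where p = "\<lambda>y. e * average y"]) auto
  then have "f = 1" by (simp add: average_one e_def)
  then show ?thesis using u by metis
qed

lemma sum_basis_average:
  assumes central: "\<And>z a. z \<in> B \<Longrightarrow> (\<And>b. b \<in> B \<Longrightarrow> b * z = z * b) \<Longrightarrow> z * a = a * z"
  shows "(\<Sum>b\<in>basis_of B. b * average (dual b * a)) = a * weight"
proof -
  have "(\<Sum>b\<in>basis_of B. b * average (dual b * a)) =
      (\<Sum>c\<in>basis_of B. average c * a * dual c)"
    unfolding average_def sum_distrib_left sum_distrib_right mult.assoc by (rule sum.swap)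
  also have "\<dots> = (\<Sum>c\<in>basis_of B. a * (average c * dual c))"
  proof (rule sum.cong[OF HOL.refl])
    fix c assume "c \<in> basis_of B"
    then have "average c \<in> B" by simp
    then have "average c * a = a * average c" by (rule central) (rule average_commute)
    then show "average c * a * dual c = a * (average c * dual c)"
      by (simp add: mult.assoc)
  qed
  also have "\<dots> = a * weight" by (simp add: weight_def sum_distrib_left)
  finally show ?thesis .
qed

end

section \<open>Casimir elements of a Frobenius extension\<close>

lemma tensor_eq_add:
  assumes "tensor_eq B M N" "tensor_eq B M' N'"
  shows "tensor_eq B (M + M') (N + N')"
  using tensor_eq.cong[OF assms(1), of M'] tensor_eq.cong[OF assms(2), of N]
  by (metis add.commute tensor_eq.trans)

lemma tensor_eq_sum:
  assumes "\<And>i. i \<in> I \<Longrightarrow> tensor_eq B (f i) (g i)"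
  shows "tensor_eq B (sum f I) (sum g I)"
  using assms
  by (induction I rule: infinite_finite_induct) (auto intro: tensor_eq.refl tensor_eq_add)

lemmas [trans] = tensor_eq.trans

text \<open>Additivity makes the class of \<open>(x, 0)\<close> idempotent, and it has an additive inverse.\<close>

lemma tensor_eq_zero_right: "tensor_eq B {#(x, 0)#} {#}"
proof -
  have pair: "tensor_eq B ({#(x, 0)#} + {#(- x, 0)#}) {#}"
    using tensor_eq_neg[of B x 0] by (simp add: add_mset_commute)
  have double: "tensor_eq B {#(x, 0)#} ({#(x, 0)#} + {#(x, 0)#})"
    using tensor_eq.add_right[of B x 0 0] by simp
  have "tensor_eq B {#(x, 0)#} ({#(x, 0)#} + ({#(x, 0)#} + {#(- x, 0)#}))"
    using tensor_eq_add[OF tensor_eq.refl[of B "{#(x, 0)#}"] tensor_eq.sym[OF pair]] by simp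
  also have "{#(x, 0)#} + ({#(x, 0)#} + {#(- x, 0)#}) = ({#(x, 0)#} + {#(x, 0)#}) + {#(- x, 0)#}"
    by (simp only: add.assoc)
  also have "tensor_eq B \<dots> ({#(x, 0)#} + {#(- x, 0)#})"
    by (rule tensor_eq.cong[OF tensor_eq.sym[OF double]])
  also have "tensor_eq B \<dots> {#}" by (rule pair)
  finally show ?thesis .
qed

lemma tensor_eq_sum_left:
  assumes "finite I"
  shows "tensor_eq B {#(\<Sum>i\<in>I. f i, y)#} (\<Sum>i\<in>I. {#(f i, y)#})"
  using assms
proof (induction I)
  case (insert i I)
  have "tensor_eq B {#(f i + sum f I, y)#} ({#(f i, y)#} + {#(sum f I, y)#})"
    using tensor_eq.add_left[of B "f i" "sum f I" y] by (simp add: add_mset_commute)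
  also have "tensor_eq B \<dots> ({#(f i, y)#} + (\<Sum>i\<in>I. {#(f i, y)#}))"
    by (intro tensor_eq_add tensor_eq.refl insert.IH)
  finally show ?case using insert.hyps by simp
qed (simp add: tensor_eq.zero)

lemma tensor_eq_sum_right:
  assumes "finite I"
  shows "tensor_eq B {#(x, \<Sum>i\<in>I. f i)#} (\<Sum>i\<in>I. {#(x, f i)#})"
  using assms
proof (induction I)
  case (insert i I)
  have "tensor_eq B {#(x, f i + sum f I)#} ({#(x, f i)#} + {#(x, sum f I)#})"
    using tensor_eq.add_right[of B x "f i" "sum f I"] by (simp add: add_mset_commute)
  also have "tensor_eq B \<dots> ({#(x, f i)#} + (\<Sum>i\<in>I. {#(x, f i)#}))"
    by (intro tensor_eq_add tensor_eq.refl insert.IH)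
  finally show ?case using insert.hyps by simp
qed (simp add: tensor_eq_zero_right)

definition centralizer :: "'a::{ring,monoid_mult} set \<Rightarrow> 'a set" where
  "centralizer B = {r. \<forall>b\<in>B. b * r = r * b}"

locale frobenius_extension =
  fixes B :: "'a::{ring,monoid_mult} set" and E :: "'a \<Rightarrow> 'a" and n :: nat and x y :: "nat \<Rightarrow> 'a"
  assumes frobenius_system: "frobenius_system B E n x y"
begin

lemma E_B [simp]: "E a \<in> B"
  and E_add: "E (a + a') = E a + E a'"
  and E_left: "b \<in> B \<Longrightarrow> E (b * a) = b * E a"
  and E_right: "b \<in> B \<Longrightarrow> E (a * b) = E a * b"
  using frobenius_system by (auto simp: frobenius_system_def bimodule_hom_def)

lemma dual_bases_right: "(\<Sum>i<n. E (a * x i) * y i) = a"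
  and dual_bases_left: "(\<Sum>i<n. x i * E (y i * a)) = a"
  using frobenius_system unfolding frobenius_system_def by (metis, metis)

lemma E_zero [simp]: "E 0 = 0"
  using E_add[of 0 0] by simp

lemma E_sum: "E (sum f I) = (\<Sum>i\<in>I. E (f i))"
  by (induction I rule: infinite_finite_induct) (auto simp: E_add)

definition casimir :: "'a \<Rightarrow> ('a \<times> 'a) multiset" where
  "casimir r = (\<Sum>i<n. {#(x i * r, y i)#})"

lemma image_casimir: "image_mset h (casimir r) = (\<Sum>i<n. {#h (x i * r, y i)#})"
proof -
  have "image_mset h (\<Sum>i<k. {#(x i * r, y i)#}) = (\<Sum>i<k. {#h (x i * r, y i)#})" for k
    by (induction k) auto
  then show ?thesis by (simp add: casimir_def)
qed

text \<open>Expanding \<open>a * x i\<close> in one dual basis yields coefficients in \<open>B\<close>, which commute with \<open>r\<close>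
  and so can be moved across the tensor sign, where the other dual basis collects them.\<close>

lemma casimir_commute:
  assumes "r \<in> centralizer B"
  shows "tensor_eq B (image_mset (\<lambda>(u, v). (a * u, v)) (casimir r))
    (image_mset (\<lambda>(u, v). (u, v * a)) (casimir r))"
proof -
  define c where "c i j = E (y j * (a * x i))" for i j
  have left: "a * (x i * r) = (\<Sum>j<n. x j * r * c i j)" for i
  proof -
    have "a * (x i * r) = (\<Sum>j<n. x j * c i j) * r"
      by (simp add: c_def dual_bases_left mult.assoc)
    then show ?thesis
      using assms by (simp add: sum_distrib_right mult.assoc centralizer_def c_def)
  qed
  have right: "(\<Sum>i<n. c i j * y i) = y j * a" for j
    using dual_bases_right[of "y j * a"] by (simp add: c_def mult.assoc)
  have "image_mset (\<lambda>(u, v). (a * u, v)) (casimir r) = (\<Sum>i<n. {#(\<Sum>j<n. x j * r * c i j, y i)#})"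
    by (simp add: image_casimir left)
  also have "tensor_eq B \<dots> (\<Sum>i<n. \<Sum>j<n. {#(x j * r * c i j, y i)#})"
    by (intro tensor_eq_sum tensor_eq_sum_left) simp
  also have "tensor_eq B \<dots> (\<Sum>i<n. \<Sum>j<n. {#(x j * r, c i j * y i)#})"
    by (intro tensor_eq_sum tensor_eq.balanced) (simp add: c_def)
  also have "(\<Sum>i<n. \<Sum>j<n. {#(x j * r, c i j * y i)#}) = (\<Sum>j<n. \<Sum>i<n. {#(x j * r, c i j * y i)#})"
    by (rule sum.swap)
  also have "tensor_eq B \<dots> (\<Sum>j<n. {#(x j * r, \<Sum>i<n. c i j * y i)#})"
    by (intro tensor_eq_sum tensor_eq.sym[OF tensor_eq_sum_right]) simp
  also have "\<dots> = image_mset (\<lambda>(u, v). (u, v * a)) (casimir r)"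
    by (simp add: image_casimir right)
  finally show ?thesis .
qed

definition casimir_map :: "'a \<Rightarrow> 'a" where
  "casimir_map r = (\<Sum>i<n. x i * r * y i)"

lemma sum_casimir:
  fixes f :: "'a \<Rightarrow> 'a \<Rightarrow> 'a"
  shows "(\<Sum>(u, v)\<in>#casimir r. f u v) = (\<Sum>i<n. f (x i * r) (y i))"
proof -
  have "\<Sum>\<^sub># (\<Sum>i<k. {#f (x i * r) (y i)#}) = (\<Sum>i<k. f (x i * r) (y i))" for k
    by (induction k) (simp_all add: add.commute)
  then show ?thesis by (simp add: image_casimir)
qed

lemma casimir_map_central:
  assumes "r \<in> centralizer B"
  shows "casimir_map r \<in> center"
proof -
  have "a * casimir_map r = casimir_map r * a" for a
    using tensor_eq_mult[OF casimir_commute[OF assms, of a]]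
      sum_casimir[of "\<lambda>u v. a * u * v" r] sum_casimir[of "\<lambda>u v. u * (v * a)" r]
    by (simp add: image_mset.compositionality o_def case_prod_unfold casimir_map_def
        sum_distrib_left sum_distrib_right mult.assoc)
  then show ?thesis by (simp add: center_def)
qed

lemma tensor_eq_apply_E:
  "tensor_eq B M N \<Longrightarrow> (\<Sum>(u, v)\<in>#M. u * E v) = (\<Sum>(u, v)\<in>#N. u * E v)"
  by (induction rule: tensor_eq.induct) (auto simp: algebra_simps E_add E_left)

text \<open>The Casimir element of a kernel element can be added to a separability element. By uniqueness
  it vanishes in the tensor product, and applying \<open>u \<otimes> v \<mapsto> u * E v\<close> to it gives back \<open>r\<close>.\<close>

lemma casimir_map_injective:
  assumes unique: "\<exists>!e. separability_element B e"
    and r: "r \<in> centralizer B" and zero: "casimir_map r = 0"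
  shows "r = 0"
proof -
  obtain e where e: "separability_element B e" using unique by blast
  then obtain M where M: "e = tensor_rel B `` {M}"
    by (auto simp: separability_element_def tensor_def elim: quotientE)
  let ?e' = "tensor_rel B `` {M + casimir r}"
  have class_eq: "tensor_rel B `` {N} = tensor_rel B `` {N'} \<longleftrightarrow> tensor_eq B N N'" for N N'
    using eq_equiv_class_iff[OF equiv_tensor_rel, of N N'] by (simp add: tensor_rel_def)
  have "tensor_left B a e = tensor_right B e a" for a
    using e by (simp add: separability_element_def)
  then have M_comm: "tensor_eq B (image_mset (\<lambda>(u, v). (a * u, v)) M) (image_mset (\<lambda>(u, v). (u, v * a)) M)" for a
    unfolding M tensor_left_class tensor_right_class class_eq .
  have "separability_element B ?e'"
    unfolding separability_element_def
  proof (intro conjI allI)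
    show "?e' \<in> tensor B" by (simp add: tensor_def quotientI)
    show "tensor_left B a ?e' = tensor_right B ?e' a" for a
      unfolding tensor_left_class tensor_right_class class_eq image_mset_union
      by (intro tensor_eq_add M_comm casimir_commute r)
    have "(\<Sum>(u, v)\<in>#M. u * v) = 1"
      using e unfolding separability_element_def M tensor_mult_class by blast
    then show "tensor_mult ?e' = 1"
      unfolding tensor_mult_class using zero
      by (simp add: sum_casimir casimir_map_def)
  qed
  then have "tensor_eq B (M + casimir r) M"
    using e unique unfolding M class_eq[symmetric] by blast
  from tensor_eq_apply_E[OF this]
  have "0 = (\<Sum>i<n. x i * r * E (y i))"
    by (simp add: sum_casimir)
  also have "\<dots> = (\<Sum>i<n. x i * E (y i * 1)) * r"
    using r by (simp add: sum_distrib_right centralizer_def mult.assoc)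
  also have "\<dots> = r" by (simp only: dual_bases_left mult_1_left)
  finally show ?thesis by simp
qed

end

section \<open>Depth one\<close>

text \<open>A factorization of the identity of \<open>A\<close> through a direct sum of copies of \<open>B\<close>: the map
  \<open>f\<close> splits \<open>g\<close>, so that the image of \<open>f\<close> and the kernel of \<open>g\<close> are complementary.\<close>

lemma depth_oneI:
  fixes B :: "'a::{ring,monoid_mult} set"
  assumes zero: "0 \<in> B" and diff: "\<And>x y. x \<in> B \<Longrightarrow> y \<in> B \<Longrightarrow> x - y \<in> B"
    and mult: "\<And>x y. x \<in> B \<Longrightarrow> y \<in> B \<Longrightarrow> x * y \<in> B"
    and K: "finite K"
    and r: "\<And>k. k \<in> K \<Longrightarrow> r k \<in> centralizer B"
    and \<phi>: "\<And>k. k \<in> K \<Longrightarrow> bimodule_hom B (*) (*) (*) (*) UNIV B (\<phi> k)"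
    and factor: "\<And>a. (\<Sum>k\<in>K. \<phi> k a * r k) = a"
  shows "depth_one B"
proof -
  obtain h where h: "bij_betw h {..<card K} K"
    using ex_bij_betw_nat_finite[OF K] by (auto simp: atLeast0LessThan)
  \<comment> \<open>The additional copy keeps their number positive when \<open>K\<close> is empty.\<close>
  define N where "N = Suc (card K)"
  define f where "f a = (\<lambda>i. if i < card K then \<phi> (h i) a else 0)" for a
  define g where "g u = (\<Sum>i<card K. u i * r (h i))" for u :: "nat \<Rightarrow> 'a"
  have hK: "h i \<in> K" if "i < card K" for i
    using h that by (auto simp: bij_betw_def)
  note hom = \<phi>[OF hK, unfolded bimodule_hom_def]
  have gf: "g (f a) = a" for a
    using sum.reindex_bij_betw[OF h, of "\<lambda>k. \<phi> k a * r k"] factor[of a]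
    by (simp add: g_def f_def)
  have f_copies: "f a \<in> copies N B" for a
    using hom zero by (auto simp: f_def copies_def N_def Pi_iff)
  have f_add: "f (a + a') = f a + f a'" for a a'
    using hom by (auto simp: f_def fun_eq_iff)
  have f_left: "f (b * a) = left_mult b (f a)" and f_right: "f (a * b) = right_mult (f a) b"
    if "b \<in> B" for a b
    using hom that by (auto simp: f_def fun_eq_iff left_mult_def right_mult_def)
  have f_diff: "f (a - a') = f a - f a'" for a a'
    using f_add[of "a - a'" a'] by (simp add: eq_diff_eq)
  have f_zero: "f 0 = 0" using f_diff[of 0 0] by simp
  have g_diff: "g (u - v) = g u - g v" for u v
    by (simp add: g_def left_diff_distrib sum_subtractf)
  have g_left: "g (left_mult b u) = b * g u" for b u
    by (simp add: g_def left_mult_def sum_distrib_left mult.assoc)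
  have g_right: "g (right_mult u b) = g u * b" if "b \<in> B" for b u
    using r[OF hK] that
    by (simp add: g_def right_mult_def sum_distrib_right mult.assoc centralizer_def)
  let ?P = "range f" and ?Q = "{u \<in> copies N B. g u = 0}"
  have copies_diff: "u - v \<in> copies N B" if "u \<in> copies N B" "v \<in> copies N B" for u v
    using that diff by (auto simp: copies_def)
  have P: "sub_bimodule B left_mult right_mult (copies N B) ?P"
    unfolding sub_bimodule_def
    using f_copies by (auto simp flip: f_diff f_left f_right simp: f_zero intro: range_eqI[of _ f 0])
  have Q: "sub_bimodule B left_mult right_mult (copies N B) ?Q"
    unfolding sub_bimodule_def
  proof (intro conjI ballI)
    show "0 \<in> ?Q" using zero by (auto simp: copies_def g_def)
    show "u - v \<in> ?Q" if "u \<in> ?Q" "v \<in> ?Q" for u v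
      using that by (auto simp: g_diff copies_diff)
    show "left_mult b u \<in> ?Q" "right_mult u b \<in> ?Q" if "b \<in> B" "u \<in> ?Q" for b u
      using that mult by (auto simp: g_left g_right) (auto simp: copies_def left_mult_def right_mult_def)
  qed auto
  have "direct_sum (copies N B) ?P ?Q"
    unfolding direct_sum_def
  proof (intro conjI equalityI subsetI)
    fix u assume u: "u \<in> copies N B"
    have "u = f (g u) + (u - f (g u))" by simp
    moreover have "u - f (g u) \<in> ?Q"
      using u by (simp add: copies_diff f_copies g_diff gf)
    ultimately show "u \<in> {p + q |p q. p \<in> ?P \<and> q \<in> ?Q}" by blast
  next
    fix u assume "u \<in> {p + q |p q. p \<in> ?P \<and> q \<in> ?Q}"
    then obtain p q where u: "u = p + q" "p \<in> copies N B" "q \<in> copies N B"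
      using f_copies by blast
    have "0 \<in> copies N B" using zero by (simp add: copies_def)
    then have "p - (0 - q) \<in> copies N B" using u by (intro copies_diff) auto
    then show "u \<in> copies N B" using u by simp
  next
    fix u assume "u \<in> ?P \<inter> ?Q"
    then obtain a where "u = f a" "g (f a) = 0" by blast
    then show "u \<in> {0}" using gf f_zero by simp
  next
    fix u :: "nat \<Rightarrow> 'a" assume "u \<in> {0}"
    then show "u \<in> ?P \<inter> ?Q" using P Q by (auto simp: sub_bimodule_def)
  qed
  then have "direct_summand B left_mult right_mult (copies N B) ?P"
    unfolding direct_summand_def using P Q by blast
  moreover have "bimodule_iso B (*) (*) left_mult right_mult UNIV ?P f"
    unfolding bimodule_iso_def bimodule_hom_def
    using inj_on_inverseI[of UNIV g f] gf
    by (auto simp: f_add f_left f_right bij_betw_def)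
  ultimately show ?thesis unfolding depth_one_def N_def by blast
qed

context semisimple_subalgebra
begin

text \<open>The injective map \<open>casimir_map\<close> takes the centralizer onto itself, by finite dimension, and
  its values are central.\<close>

lemma centralizer_subset_center:
  assumes "frobenius_system B E n x y" and "\<exists>!e. separability_element B e"
  shows "centralizer B \<subseteq> center"
proof -
  interpret frobenius_extension B E n x y by unfold_locales fact
  have subspace: "subspace (centralizer B)"
    unfolding subspace_def centralizer_def
    by (simp add: distrib_left distrib_right flip: scale_mult_left scale_mult_right)
  have linear: "Vector_Spaces.linear scale scale casimir_map"
    unfolding casimir_map_def by (intro linear_sum_maps linear_mult_both)
  have "center \<subseteq> centralizer B"
    unfolding center_def centralizer_def by fastforce
  then have into: "casimir_map ` centralizer B \<subseteq> centralizer B"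
    using casimir_map_central by blast
  have "casimir_map ` centralizer B = centralizer B"
    by (rule linear_injective_onto[OF subspace linear into casimir_map_injective[OF assms(2)]])
  then show ?thesis
    using casimir_map_central by (metis image_subsetI)
qed

lemma average_centralizer: "average a \<in> centralizer B"
  unfolding centralizer_def using average_commute by blast

text \<open>The coefficients \<open>r (i, b)\<close> express \<open>x i\<close> through the basis of \<open>B\<close>; being central, they can be
  moved to the right in \<open>a = \<Sum>i. x i * E (y i * a)\<close>, which turns it into an expansion with
  coefficient maps \<open>a \<mapsto> b * E (y i * a)\<close>. These are right but not left \<open>B\<close>-linear. Replacing each
  by \<open>a \<mapsto> \<Sum>c. c * b * E (y i * dual c * a) = E (s (i, b) * a)\<close> repairs this, and keeps the
  expansion valid because \<open>\<Sum>c. c * dual c = 1\<close>.\<close>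

lemma depth_one_if_central:
  assumes frob: "frobenius_system B E n x y" and central: "centralizer B \<subseteq> center"
  shows "depth_one B"
proof -
  interpret frobenius_extension B E n x y by unfold_locales fact
  obtain u where u: "u \<in> B" "u * weight = 1" using weight_invertible by blast
  define r where "r = (\<lambda>(i, b). average (dual b * (x i * u)))"
  define s where "s = (\<lambda>(i, b). average (b * y i))"
  let ?K = "{..<n} \<times> basis_of B"
  have expand_x: "x i = (\<Sum>b\<in>basis_of B. b * r (i, b))" for i
  proof -
    have "(\<Sum>b\<in>basis_of B. b * average (dual b * (x i * u))) = x i * u * weight"
      using central by (intro sum_basis_average) (auto simp: center_def centralizer_def)
    then show ?thesis using u(2) by (simp add: r_def mult.assoc)
  qed
  have r_central: "r k * a = a * r k" for k a
    using central average_centralizer by (auto simp: r_def center_def split: prod.split)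
  have factor: "(\<Sum>k\<in>?K. E (s k * a) * r k) = a" for a
  proof -
    have x_expansion: "(\<Sum>k\<in>?K. snd k * E (y (fst k) * a') * r k) = a'" for a'
    proof -
      have "(\<Sum>k\<in>?K. snd k * E (y (fst k) * a') * r k) =
          (\<Sum>i<n. \<Sum>b\<in>basis_of B. b * r (i, b) * E (y i * a'))"
        by (simp add: sum.cartesian_product case_prod_unfold mult.assoc r_central)
      also have "\<dots> = (\<Sum>i<n. x i * E (y i * a'))"
        by (simp flip: sum_distrib_right expand_x)
      finally show ?thesis by (simp add: dual_bases_left)
    qed
    have "E (s k * a) = (\<Sum>c\<in>basis_of B. c * (snd k * E (y (fst k) * (dual c * a))))"
      if "k \<in> ?K" for k
      using that
      by (auto simp: s_def average_def sum_distrib_right E_sum E_left mult.assoc)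
    then have "(\<Sum>k\<in>?K. E (s k * a) * r k) =
        (\<Sum>k\<in>?K. \<Sum>c\<in>basis_of B. c * (snd k * E (y (fst k) * (dual c * a)) * r k))"
      by (simp add: sum_distrib_right mult.assoc)
    also have "\<dots> = (\<Sum>c\<in>basis_of B. c * (\<Sum>k\<in>?K. snd k * E (y (fst k) * (dual c * a)) * r k))"
      by (subst sum.swap) (simp add: sum_distrib_left)
    also have "\<dots> = average 1 * a"
      unfolding x_expansion by (simp add: average_def sum_distrib_right mult.assoc)
    finally show ?thesis by (simp add: average_one)
  qed
  have hom: "bimodule_hom B (*) (*) (*) (*) UNIV B (\<lambda>a. E (s k * a))" for k
  proof -
    have left: "E (s k * (b * a)) = b * E (s k * a)" if b: "b \<in> B" for a b
    proof -
      have "s k * b = b * s k"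
        using average_commute[OF b] by (cases k) (simp add: s_def)
      then have "s k * (b * a) = b * (s k * a)" by (metis mult.assoc)
      then show ?thesis using E_left[OF b] by simp
    qed
    have right: "E (s k * (a * b)) = E (s k * a) * b" if "b \<in> B" for a b
      using E_right[OF that, of "s k * a"] by (simp only: mult.assoc)
    show ?thesis
      unfolding bimodule_hom_def using left right by (auto simp: distrib_left E_add)
  qed
  have r_centralizer: "r k \<in> centralizer B" for k
    by (simp add: centralizer_def r_central)
  have "finite ?K" using finite_basis_of by simp
  show ?thesis
    by (rule depth_oneI[OF zero_B diff_B mult_B \<open>finite ?K\<close> r_centralizer hom factor])
qed

end

theorem corollary4p3:
  fixes scale :: "complex \<Rightarrow> 'a::{ring,monoid_mult} \<Rightarrow> 'a"
    and B :: "'a set"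
  assumes "complex_algebra scale"
    and "fd_semisimple_algebra scale UNIV"
    and "fd_semisimple_algebra scale B"
    and "uniquely_separable_frobenius B"
  shows "depth_one B"
proof -
  interpret complex_algebra scale by fact
  obtain S where S: "finite S" "span S = UNIV"
    using assms(2) by (auto simp: fd_semisimple_algebra_def finite_dimensional_def)
  obtain Basis where "Basis \<subseteq> S" "independent Basis" "S \<subseteq> span Basis"
    by (rule maximal_independent_subset[of S]) blast
  then have "finite Basis" "independent Basis" "span Basis = UNIV"
    using S span_minimal[of S "span Basis"] by (auto intro: finite_subset)
  then interpret semisimple_subalgebra scale Basis B
    using assms(3) by unfold_locales (auto simp: fd_semisimple_algebra_def)
  obtain E n x y where "frobenius_system B E n x y" and "\<exists>!e. separability_element B e"
    using assms(4) by (auto simp: uniquely_separable_frobenius_def)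
  then show ?thesis
    using centralizer_subset_center depth_one_if_central by metis
qed

end
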